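(* Let $L>0$ and let $f\in\Gamma(\mathbb{R}^d)$. Then $f$ is $L$-smooth if and only if any one of the following conditions holds (that is, each of the three conditions is individually equivalent to $L$-smoothness of $f$): (a) $f^*(\lambda u+(1-\lambda)v)\le \lambda f^*(u)+(1-\lambda)f^*(v)-\frac{1}{2L}\lambda(1-\lambda)\|u-v\|^2$ for all $u,v\in\mathbb{R}^d$, $\lambda\in[0,1]$; (b) $\langle\nabla f^*(u)-\nabla f^*(v),u-v\rangle\ge\frac1L\|u-v\|^2$ for all $u,v\in\mathbb{R}^d$; (c) $f^*(u)\ge f^*(v)+\langle\nabla f^*(v),u-v\rangle+\frac{1}{2L}\|u-v\|^2$ for all $u,v\in\mathbb{R}^d$.
   Context: $\mathbb{R}^d$ carries the dot product $\langle\cdot,\cdot\rangle$ and the induced Euclidean norm $\|\cdot\|$. The conjugate of $f$ is $f^*(u)=\sup_{x\in\mathbb{R}^d}\{\langle x,u\rangle-f(x)\}$. $\Gamma(\mathbb{R}^d)$ denotes the class of functions $f:\mathbb{R}^d\to\mathbb{R}$ that are convex and differentiable and whose conjugate $f^*$ is differentiable (on all of $\mathbb{R}^d$, in particular finite everywhere). For a differentiable function $h$, the Bregman distance is $D_h(x,y):=h(x)-h(y)-\langle\nabla h(y),x-y\rangle$. Let $\varphi_0=\frac12\|\cdot\|^2$. A differentiable function $f$ is called $L$-smooth if $D_f(x,y)\le L\,D_{\varphi_0}(x,y)$ for all $x,y\in\mathbb{R}^d$. *)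

theory Defs
  imports "HOL-Analysis.Analysis"
begin

text \<open>The gradient is only meaningful at points of differentiability; there it is the unique
  vector representing the Frechet derivative through the inner product.\<close>

definition gradient :: "('a::euclidean_space \<Rightarrow> real) \<Rightarrow> 'a \<Rightarrow> 'a" where
  "gradient h x = (THE g. GDERIV h x :> g)"

text \<open>The conjugate is a supremum in the extended reals, so that finiteness is a genuine
  condition rather than a convention about suprema of unbounded sets.\<close>

definition conjugate :: "('a::euclidean_space \<Rightarrow> real) \<Rightarrow> 'a \<Rightarrow> ereal" where
  "conjugate f u = (SUP x. ereal (x \<bullet> u - f x))"

text \<open>The real-valued version; it represents the conjugate only where the latter is finite,
  in particular everywhere for functions of the class \<open>Gamma_fun\<close> below.\<close>

definition conjugate_real :: "('a::euclidean_space \<Rightarrow> real) \<Rightarrow> 'a \<Rightarrow> real" where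
  "conjugate_real f u = real_of_ereal (conjugate f u)"

definition Gamma_fun :: "('a::euclidean_space \<Rightarrow> real) set" where
  "Gamma_fun = {f. convex_on UNIV f
     \<and> (\<forall>x. f differentiable (at x))
     \<and> (\<forall>u. \<bar>conjugate f u\<bar> \<noteq> \<infinity>)
     \<and> (\<forall>u. conjugate_real f differentiable (at u))}"

definition bregman :: "('a::euclidean_space \<Rightarrow> real) \<Rightarrow> 'a \<Rightarrow> 'a \<Rightarrow> real" where
  "bregman h x y = h x - h y - gradient h y \<bullet> (x - y)"

definition phi0 :: "'a::euclidean_space \<Rightarrow> real" where
  "phi0 x = 1 / 2 * (norm x)\<^sup>2"

definition L_smooth :: "real \<Rightarrow> ('a::euclidean_space \<Rightarrow> real) \<Rightarrow> bool" where
  "L_smooth L f \<longleftrightarrow> (\<forall>x. f differentiable (at x))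
     \<and> (\<forall>x y. bregman f x y \<le> L * bregman phi0 x y)"

end

theory Submission
  imports Defs
begin

text \<open>
  Write \<open>g\<close> for the conjugate of \<open>f\<close>. Two independent facts make the theorem true.

  First, the three conditions are all ways of saying that \<open>g\<close> is strongly convex with
  modulus \<open>1 / L\<close>, and they are equivalent for every differentiable function. The pivot is the
  quadratic lower bound (c). It follows from the secant inequality (a) by letting the weight tend
  to \<open>0\<close>, and from strong monotonicity (b) because the gap between \<open>g\<close> and its quadratic lower
  bound is nondecreasing along rays from the base point. Conversely, (a) is a convex combination
  of two instances of (c) based at the intermediate point, and (b) is the sum of two instances with
  exchanged arguments.

  Second, conjugation turns the quadratic upper bound that defines \<open>L\<close>-smoothness of \<open>f\<close> into
  (c) for \<open>g\<close>. On the class considered here the gradients of \<open>f\<close> and \<open>g\<close> are inverse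
  bijections, so tangency points of \<open>f\<close> correspond to tangency points of \<open>g\<close>, and at such pairs
  the Fenchel-Young inequality is an equality
  (\<open>fenchel_young_equality\<close>, \<open>gradient_conjugate_gradient\<close>, \<open>gradient_gradient_conjugate\<close>).
  Inserting these equalities in either bound gives the other one, since the conjugate of
  \<open>L / 2 * (norm x)\<^sup>2\<close> is \<open>1 / (2 * L) * (norm u)\<^sup>2\<close>
  (\<open>L_smooth_iff_quadratic_lower_bound_conjugate\<close>). The one nontrivial point is that every \<open>u\<close> is a
  gradient of \<open>f\<close>; it holds because finiteness of the conjugate makes \<open>f\<close> minus any linear
  functional coercive, so that the supremum defining the conjugate is attained.
\<close>

section \<open>Gradients\<close>

lemma gradient_eqI:
  fixes h :: "'a::euclidean_space \<Rightarrow> real"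
  assumes "GDERIV h x :> g"
  shows "gradient h x = g"
  unfolding gradient_def
proof (rule the_equality)
  show "GDERIV h x :> g" by (rule assms)
next
  fix g'
  assume "GDERIV h x :> g'"
  then have "(\<lambda>y. y \<bullet> g') = (\<lambda>y. y \<bullet> g)"
    using assms unfolding gderiv_def by (rule has_derivative_unique)
  then show "g' = g"
    by (metis vector_eq_ldot)
qed

lemma GDERIV_gradient:
  fixes h :: "'a::euclidean_space \<Rightarrow> real"
  assumes "h differentiable (at x)"
  shows "GDERIV h x :> gradient h x"
proof -
  obtain h' where h': "(h has_derivative h') (at x)"
    using assms by (auto simp: differentiable_def)
  then interpret linear h'
    by (rule has_derivative_linear)
  define g where "g = (\<Sum>b\<in>Basis. h' b *\<^sub>R b)"
  have "h' y = y \<bullet> g" for y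
  proof -
    have "h' y = h' (\<Sum>b\<in>Basis. (y \<bullet> b) *\<^sub>R b)"
      by (simp add: euclidean_representation)
    also have "\<dots> = y \<bullet> g"
      by (simp add: sum scale g_def inner_sum_right mult.commute)
    finally show ?thesis .
  qed
  then have "GDERIV h x :> g"
    using h' unfolding gderiv_def by (metis (no_types, lifting) ext)
  then show ?thesis
    using gradient_eqI by metis
qed

text \<open>The difference of \<open>h\<close> and its supporting affine function attains its minimum at the point of
  contact, so its derivative vanishes there.\<close>

lemma gradient_eq_subgradient:
  fixes h :: "'a::euclidean_space \<Rightarrow> real"
  assumes "h differentiable (at x)" and "\<And>y. h x + s \<bullet> (y - x) \<le> h y"
  shows "gradient h x = s"
proof -
  have "((\<lambda>y. h y - y \<bullet> s) has_derivative (\<lambda>y. y \<bullet> gradient h x - y \<bullet> s)) (at x)"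
    using GDERIV_gradient[OF assms(1)] unfolding gderiv_def
    by (auto intro!: derivative_eq_intros)
  moreover have "h x - x \<bullet> s \<le> h y - y \<bullet> s" for y
    using assms(2)[of y] by (simp add: inner_diff_right inner_commute)
  ultimately have "(\<lambda>y. y \<bullet> gradient h x - y \<bullet> s) = (\<lambda>y. 0)"
    by (intro differential_zero_maxmin[of x UNIV "\<lambda>y. h y - y \<bullet> s"]) auto
  then have "(gradient h x - s) \<bullet> (gradient h x - s) = 0"
    by (metis inner_diff_right)
  then show ?thesis by simp
qed

lemma has_real_derivative_along_line:
  fixes h :: "'a::euclidean_space \<Rightarrow> real"
  assumes "h differentiable (at (v + t *\<^sub>R w))"
  shows "((\<lambda>t. h (v + t *\<^sub>R w)) has_real_derivative gradient h (v + t *\<^sub>R w) \<bullet> w) (at t)"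
proof -
  have "((\<lambda>t. v + t *\<^sub>R w) has_derivative (\<lambda>t. t *\<^sub>R w)) (at t)"
    by (auto intro!: derivative_eq_intros)
  then have "((\<lambda>t. h (v + t *\<^sub>R w)) has_derivative
      (\<lambda>s. (s *\<^sub>R w) \<bullet> gradient h (v + t *\<^sub>R w))) (at t)"
    using GDERIV_gradient[OF assms] unfolding gderiv_def
    by (rule has_derivative_compose[where g = h])
  then show ?thesis
    unfolding has_field_derivative_def
    by (rule has_derivative_eq_rhs) (auto simp: inner_commute mult.commute)
qed

lemma bregman_phi0: "bregman phi0 x y = 1 / 2 * (norm (x - y))\<^sup>2"
proof -
  have "GDERIV phi0 y :> y"
    unfolding gderiv_def phi0_def power2_norm_eq_inner
    by (auto intro!: derivative_eq_intros simp: inner_commute)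
  then have "gradient phi0 y = y"
    by (rule gradient_eqI)
  then show ?thesis
    by (simp add: bregman_def phi0_def power2_norm_eq_inner inner_diff_left inner_diff_right
        inner_commute field_simps)
qed

section \<open>Characterizations of strong convexity\<close>

text \<open>Dividing the assumption by \<open>t\<close> bounds the difference quotient of \<open>g\<close> at \<open>v\<close> in direction
  \<open>u - v\<close>; the bound passes to the limit. For \<open>c = 0\<close> this is the tangent inequality
  of convex functions.\<close>

lemma strongly_convex_imp_quadratic_lower_bound:
  fixes g :: "'a::euclidean_space \<Rightarrow> real"
  assumes diff: "g differentiable (at v)"
    and conv: "\<And>t. 0 < t \<Longrightarrow> t < 1 \<Longrightarrow>
      g (t *\<^sub>R u + (1 - t) *\<^sub>R v) \<le> t * g u + (1 - t) * g v - c * t * (1 - t) * (norm (u - v))\<^sup>2"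
  shows "g v + gradient g v \<bullet> (u - v) + c * (norm (u - v))\<^sup>2 \<le> g u"
proof -
  let ?q = "\<lambda>t. (g (v + t *\<^sub>R (u - v)) - g v) / t"
  have "((\<lambda>t. g (v + t *\<^sub>R (u - v))) has_real_derivative gradient g v \<bullet> (u - v)) (at 0)"
    using has_real_derivative_along_line[of g v 0 "u - v"] diff by simp
  then have "?q \<midarrow>0\<rightarrow> gradient g v \<bullet> (u - v)"
    by (simp add: DERIV_def)
  then have lim: "(?q \<longlongrightarrow> gradient g v \<bullet> (u - v)) (at_right 0)"
    by (rule filterlim_mono) (auto simp: at_le)
  have lim': "((\<lambda>t. g u - g v - c * (1 - t) * (norm (u - v))\<^sup>2) \<longlongrightarrow>
      g u - g v - c * (1 - 0) * (norm (u - v))\<^sup>2) (at_right 0)"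
    by (intro tendsto_intros)
  have "\<forall>\<^sub>F t in at_right 0. ?q t \<le> g u - g v - c * (1 - t) * (norm (u - v))\<^sup>2"
  proof -
    have "\<forall>\<^sub>F t::real in at_right 0. 0 < t \<and> t < 1"
      by (auto simp: eventually_at_right[of 0 1] intro: exI[of _ 1])
    then show ?thesis
    proof eventually_elim
      case (elim t)
      have "v + t *\<^sub>R (u - v) = t *\<^sub>R u + (1 - t) *\<^sub>R v"
        by (simp add: algebra_simps)
      then have "g (v + t *\<^sub>R (u - v)) - g v
          \<le> (g u - g v - c * (1 - t) * (norm (u - v))\<^sup>2) * t"
        using conv[of t] elim by (simp add: algebra_simps)
      then show ?case
        using elim by (simp only: pos_divide_le_eq)
    qed
  qed
  from tendsto_le[OF _ lim' lim this] show ?thesis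
    by simp
qed

text \<open>In the convex combination of the bounds based at the intermediate point, the gradient terms
  cancel and the squares add up by
  \<open>t * (1 - t)\<^sup>2 + (1 - t) * t\<^sup>2 = t * (1 - t)\<close>.\<close>

lemma quadratic_lower_bound_imp_strongly_convex:
  fixes g :: "'a::euclidean_space \<Rightarrow> real"
  assumes bound: "\<And>u v. g v + gradient g v \<bullet> (u - v) + c * (norm (u - v))\<^sup>2 \<le> g u"
    and t: "t \<in> {0..1}"
  shows "g (t *\<^sub>R u + (1 - t) *\<^sub>R v) \<le> t * g u + (1 - t) * g v - c * t * (1 - t) * (norm (u - v))\<^sup>2"
proof -
  let ?z = "t *\<^sub>R u + (1 - t) *\<^sub>R v" and ?n = "(norm (u - v))\<^sup>2"
  let ?s = "gradient g ?z \<bullet> (u - v)"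
  have u: "u - ?z = (1 - t) *\<^sub>R (u - v)" and v: "v - ?z = (- t) *\<^sub>R (u - v)"
    by (simp_all add: algebra_simps)
  have "g ?z + (1 - t) * ?s + c * ((1 - t)\<^sup>2 * ?n) \<le> g u"
    using bound[of ?z u] unfolding u by (simp add: power_mult_distrib)
  then have "t * (g ?z + (1 - t) * ?s + c * ((1 - t)\<^sup>2 * ?n)) \<le> t * g u"
    using t by (intro mult_left_mono) auto
  moreover have "g ?z - t * ?s + c * (t\<^sup>2 * ?n) \<le> g v"
    using bound[of ?z v] unfolding v by (simp add: power_mult_distrib)
  then have "(1 - t) * (g ?z - t * ?s + c * (t\<^sup>2 * ?n)) \<le> (1 - t) * g v"
    using t by (intro mult_left_mono) auto
  ultimately show ?thesis
    by (simp add: algebra_simps power2_eq_square)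
qed

text \<open>Strong monotonicity, applied to the endpoints of the segment from \<open>v\<close> to
  \<open>v + t *\<^sub>R (u - v)\<close> and divided by \<open>t\<close>, says that the gap in the bound has a nonnegative
  derivative in \<open>t\<close>.\<close>

lemma strongly_monotone_gradient_imp_quadratic_lower_bound:
  fixes g :: "'a::euclidean_space \<Rightarrow> real"
  assumes diff: "\<And>x. g differentiable (at x)"
    and mono: "\<And>u v. 2 * c * (norm (u - v))\<^sup>2 \<le> (gradient g u - gradient g v) \<bullet> (u - v)"
  shows "g v + gradient g v \<bullet> (u - v) + c * (norm (u - v))\<^sup>2 \<le> g u"
proof -
  let ?w = "u - v"
  let ?p = "\<lambda>t. g (v + t *\<^sub>R ?w) - t * (gradient g v \<bullet> ?w) - c * t\<^sup>2 * (norm ?w)\<^sup>2"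
  have "?p 0 \<le> ?p 1"
  proof (rule DERIV_nonneg_imp_nondecreasing[where f = ?p])
    fix t :: real
    assume t: "0 \<le> t"
    let ?d = "gradient g (v + t *\<^sub>R ?w) \<bullet> ?w - gradient g v \<bullet> ?w - 2 * c * t * (norm ?w)\<^sup>2"
    have "(?p has_real_derivative ?d) (at t)"
      by (auto intro!: derivative_eq_intros has_real_derivative_along_line diff)
    moreover have "0 \<le> ?d"
    proof (cases "t = 0")
      case False
      have "2 * c * (t\<^sup>2 * (norm ?w)\<^sup>2)
          \<le> t * ((gradient g (v + t *\<^sub>R ?w) - gradient g v) \<bullet> ?w)"
        using mono[of "v + t *\<^sub>R ?w" v] by (simp add: power_mult_distrib)
      then have "0 \<le> t * ?d"
        by (simp add: algebra_simps power2_eq_square)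
      then show ?thesis
        using t False by (simp add: zero_le_mult_iff)
    qed simp
    ultimately show "\<exists>y. (?p has_real_derivative y) (at t) \<and> 0 \<le> y"
      by blast
  qed simp
  then show ?thesis
    by simp
qed

lemma quadratic_lower_bound_imp_strongly_monotone_gradient:
  fixes g :: "'a::euclidean_space \<Rightarrow> real"
  assumes bound: "\<And>u v. g v + gradient g v \<bullet> (u - v) + c * (norm (u - v))\<^sup>2 \<le> g u"
  shows "2 * c * (norm (u - v))\<^sup>2 \<le> (gradient g u - gradient g v) \<bullet> (u - v)"
  using bound[of v u] bound[of u v]
  by (simp add: norm_minus_commute[of v u] inner_diff_left inner_diff_right)

lemma convex_on_above_tangent_plane:
  fixes f :: "'a::euclidean_space \<Rightarrow> real"
  assumes "convex_on UNIV f" and "f differentiable (at y)"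
  shows "f y + gradient f y \<bullet> (x - y) \<le> f x"
  using strongly_convex_imp_quadratic_lower_bound[of f y x 0] assms
  by (simp add: convex_on_def)

section \<open>Conjugate pairs of gradients\<close>

lemma fenchel_young:
  assumes "\<bar>conjugate f u\<bar> \<noteq> \<infinity>"
  shows "x \<bullet> u \<le> f x + conjugate_real f u"
proof -
  have "ereal (x \<bullet> u - f x) \<le> conjugate f u"
    unfolding conjugate_def by (rule SUP_upper) simp
  also have "\<dots> = ereal (conjugate_real f u)"
    using assms by (simp add: conjugate_real_def ereal_real)
  finally show ?thesis by simp
qed

lemma conjugate_real_eq_maximum:
  assumes "\<And>y. y \<bullet> u - f y \<le> x \<bullet> u - f x"
  shows "conjugate_real f u = x \<bullet> u - f x"
proof -
  have "conjugate f u = ereal (x \<bullet> u - f x)"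
    unfolding conjugate_def using assms
    by (intro antisym SUP_least SUP_upper) auto
  then show ?thesis by (simp add: conjugate_real_def)
qed

lemma Gamma_funD:
  assumes "f \<in> Gamma_fun"
  shows "convex_on UNIV f" and "f differentiable (at x)"
    and "\<bar>conjugate f u\<bar> \<noteq> \<infinity>" and "conjugate_real f differentiable (at u)"
  using assms by (auto simp: Gamma_fun_def)

lemma fenchel_young_equality:
  assumes "f \<in> Gamma_fun"
  shows "conjugate_real f (gradient f x) = x \<bullet> gradient f x - f x"
proof (rule conjugate_real_eq_maximum)
  fix y
  show "y \<bullet> gradient f x - f y \<le> x \<bullet> gradient f x - f x"
    using convex_on_above_tangent_plane[OF Gamma_funD(1,2)[OF assms], of x y]
    by (simp add: inner_diff_right inner_commute)
qed

text \<open>By the Fenchel-Young inequality, \<open>x\<close> is a subgradient of the conjugate at the gradient of \<open>f\<close>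
  at \<open>x\<close>; differentiability of the conjugate leaves no other candidate for its gradient.\<close>

lemma gradient_conjugate_gradient:
  assumes "f \<in> Gamma_fun"
  shows "gradient (conjugate_real f) (gradient f x) = x"
proof (rule gradient_eq_subgradient)
  show "conjugate_real f differentiable at (gradient f x)"
    by (rule Gamma_funD(4)[OF assms])
  show "conjugate_real f (gradient f x) + x \<bullet> (u - gradient f x) \<le> conjugate_real f u" for u
    using fenchel_young[OF Gamma_funD(3)[OF assms], of x u]
    by (simp add: fenchel_young_equality[OF assms] inner_diff_right)
qed

text \<open>The Fenchel-Young inequality at the finitely many points \<open>u + b\<close> and \<open>u - b\<close>, for \<open>b\<close> a basis
  vector, bounds every coordinate of \<open>x\<close> in terms of \<open>f x - x \<bullet> u\<close>.\<close>

lemma finite_conjugate_imp_coercive: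
  fixes f :: "'a::euclidean_space \<Rightarrow> real"
  assumes "\<And>u. \<bar>conjugate f u\<bar> \<noteq> \<infinity>"
  obtains B where "\<And>x. norm x \<le> real DIM('a) * (f x - x \<bullet> u + B)"
proof -
  define B where "B = (\<Sum>b\<in>Basis. \<bar>conjugate_real f (u + b)\<bar> + \<bar>conjugate_real f (u - b)\<bar>)"
  have "norm x \<le> real DIM('a) * (f x - x \<bullet> u + B)" for x
  proof -
    have "\<bar>x \<bullet> b\<bar> \<le> f x - x \<bullet> u + B" if b: "b \<in> Basis" for b
    proof -
      have "\<bar>conjugate_real f (u + b)\<bar> + \<bar>conjugate_real f (u - b)\<bar> \<le> B"
        unfolding B_def using b by (intro member_le_sum) auto
      then show ?thesis
        using fenchel_young[OF assms, of x "u + b"] fenchel_young[OF assms, of x "u - b"]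
        by (simp add: inner_add_right inner_diff_right)
    qed
    then have "(\<Sum>b\<in>Basis. \<bar>x \<bullet> b\<bar>) \<le> real DIM('a) * (f x - x \<bullet> u + B)"
      by (rule sum_bounded_above)
    then show ?thesis
      using norm_le_l1[of x] by linarith
  qed
  then show thesis by (rule that)
qed

text \<open>By coercivity \<open>y \<mapsto> f y - y \<bullet> u\<close> attains its minimum at some \<open>x\<close>, where the gradient of
  \<open>f\<close> is then \<open>u\<close>. So the gradient of \<open>f\<close> is surjective, and its left inverse, the gradient of the
  conjugate, is also a right inverse.\<close>

lemma gradient_gradient_conjugate:
  fixes f :: "'a::euclidean_space \<Rightarrow> real"
  assumes "f \<in> Gamma_fun"
  shows "gradient f (gradient (conjugate_real f) u) = u"
proof -
  obtain B where B: "\<And>x. norm x \<le> real DIM('a) * (f x - x \<bullet> u + B)"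
    using finite_conjugate_imp_coercive[where f = f and u = u, OF Gamma_funD(3)[OF assms]] by blast
  \<comment> \<open>By coercivity, points outside the ball of this radius have values above the value at \<open>0\<close>.\<close>
  let ?R = "real DIM('a) * (f 0 + B)"
  have R: "0 \<le> ?R"
    using B[of 0] by simp
  have "continuous_on (cball 0 ?R) (\<lambda>x. f x - x \<bullet> u)"
    by (intro continuous_intros continuous_at_imp_continuous_on ballI
        differentiable_imp_continuous_within Gamma_funD(2)[OF assms])
  moreover have "compact (cball (0::'a) ?R)" "cball (0::'a) ?R \<noteq> {}"
    using R by (simp_all only: compact_cball cball_eq_empty not_less not_False_eq_True)
  ultimately obtain x where x: "\<And>y. y \<in> cball 0 ?R \<Longrightarrow> f x - x \<bullet> u \<le> f y - y \<bullet> u"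
    using continuous_attains_inf[of "cball (0::'a) ?R" "\<lambda>x. f x - x \<bullet> u"]
    by blast
  have "f x - x \<bullet> u \<le> f y - y \<bullet> u" for y
  proof (rule ccontr)
    assume "\<not> ?thesis"
    then have "f y - y \<bullet> u < f 0" "y \<notin> cball 0 ?R"
      using x[of 0] x[of y] R by auto
    moreover have "real DIM('a) * (f y - y \<bullet> u + B) \<le> real DIM('a) * (f 0 + B)"
      using \<open>f y - y \<bullet> u < f 0\<close> by (intro mult_left_mono) auto
    ultimately show False
      using B[of y] by auto
  qed
  then have "f x - x \<bullet> u + y \<bullet> u \<le> f y" for y
    by (simp add: le_diff_eq)
  then have "f x + u \<bullet> (y - x) \<le> f y" for y
    by (simp add: inner_diff_right inner_commute[of u] algebra_simps)
  then have "gradient f x = u"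
    by (intro gradient_eq_subgradient Gamma_funD(2)[OF assms])
  then show ?thesis
    using gradient_conjugate_gradient[OF assms, of x] by simp
qed

section \<open>Smoothness and strong convexity under conjugation\<close>

text \<open>Forward, the conjugate is bounded below by testing its supremum at a single point, chosen
  optimally for the quadratic upper bound on \<open>f\<close>. Backward, \<open>f\<close> is expressed at both points by
  the Fenchel-Young equality, and the loss is controlled by Young's inequality
  \<open>p \<bullet> q \<le> L / 2 * (norm p)\<^sup>2 + 1 / (2 * L) * (norm q)\<^sup>2\<close>.\<close>

lemma L_smooth_iff_quadratic_lower_bound_conjugate:
  fixes f :: "'a::euclidean_space \<Rightarrow> real"
  assumes L: "L > 0" and f: "f \<in> Gamma_fun"
  shows "L_smooth L f \<longleftrightarrow> (\<forall>u v. conjugate_real f v + gradient (conjugate_real f) v \<bullet> (u - v)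
    + 1 / (2 * L) * (norm (u - v))\<^sup>2 \<le> conjugate_real f u)"
    (is "_ \<longleftrightarrow> ?bound")
proof
  assume smooth: "L_smooth L f"
  show ?bound
  proof (intro allI)
    fix u v
    define y where "y = gradient (conjugate_real f) v"
    have v: "gradient f y = v"
      unfolding y_def by (rule gradient_gradient_conjugate[OF f])
    \<comment> \<open>The maximizer of \<open>x \<bullet> u\<close> minus the quadratic upper bound on \<open>f\<close> at \<open>y\<close>.\<close>
    define x where "x = y + (1 / L) *\<^sub>R (u - v)"
    have n: "L * (norm (x - y))\<^sup>2 = 1 / L * (norm (u - v))\<^sup>2"
      using L by (simp add: x_def power_mult_distrib power2_eq_square)
    have "f x \<le> f y + v \<bullet> (x - y) + L / 2 * (norm (x - y))\<^sup>2"
    proof -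
      have "bregman f x y \<le> L * (1 / 2 * (norm (x - y))\<^sup>2)"
        using smooth unfolding L_smooth_def bregman_phi0 by blast
      then show ?thesis
        by (simp add: bregman_def v)
    qed
    moreover have "conjugate_real f v = y \<bullet> v - f y"
      using fenchel_young_equality[OF f, of y] by (simp add: v)
    moreover have "x \<bullet> u \<le> f x + conjugate_real f u"
      by (rule fenchel_young[OF Gamma_funD(3)[OF f]])
    moreover have "x \<bullet> u - v \<bullet> (x - y) = y \<bullet> u + 1 / L * (norm (u - v))\<^sup>2"
      by (simp add: x_def power2_norm_eq_inner inner_add_left inner_diff_left inner_diff_right
          inner_commute algebra_simps)
    ultimately show "conjugate_real f v + gradient (conjugate_real f) v \<bullet> (u - v)
        + 1 / (2 * L) * (norm (u - v))\<^sup>2 \<le> conjugate_real f u"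
      using n unfolding y_def[symmetric] by (simp add: inner_diff_right)
  qed
next
  assume bound: ?bound
  have "bregman f x y \<le> L * bregman phi0 x y" for x y
  proof -
    let ?u = "gradient f x" and ?v = "gradient f y"
    have "x \<bullet> ?u - f x \<ge> y \<bullet> ?v - f y + y \<bullet> (?u - ?v) + 1 / (2 * L) * (norm (?u - ?v))\<^sup>2"
      using bound[rule_format, of ?v ?u]
      by (simp add: fenchel_young_equality[OF f] gradient_conjugate_gradient[OF f])
    then have "bregman f x y \<le> (x - y) \<bullet> (?u - ?v) - 1 / (2 * L) * (norm (?u - ?v))\<^sup>2"
      by (simp add: bregman_def inner_diff_left inner_diff_right inner_commute)
    also have "\<dots> \<le> L / 2 * (norm (x - y))\<^sup>2"
    proof -
      have "0 \<le> 1 / (2 * L) * (norm (L *\<^sub>R (x - y) - (?u - ?v)))\<^sup>2"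
        using L by simp
      also have "(norm (L *\<^sub>R (x - y) - (?u - ?v)))\<^sup>2
          = L * (L * (norm (x - y))\<^sup>2) - 2 * L * ((x - y) \<bullet> (?u - ?v)) + (norm (?u - ?v))\<^sup>2"
        unfolding power2_norm_eq_inner inner_diff_left[of "L *\<^sub>R (x - y)"]
          inner_diff_right[of _ "L *\<^sub>R (x - y)"]
        by (simp add: inner_commute)
      finally show ?thesis
        using L by (simp add: field_simps)
    qed
    finally show ?thesis
      by (simp add: bregman_phi0)
  qed
  then show "L_smooth L f"
    using Gamma_funD(2)[OF f] by (simp add: L_smooth_def)
qed

theorem proposition3p2:
  fixes f :: "real ^ 'd \<Rightarrow> real" and L :: real
  assumes "L > 0"
    and "f \<in> Gamma_fun"
  shows "(L_smooth L f \<longleftrightarrow>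
          (\<forall>u v. \<forall>t\<in>{0..1}.
             conjugate_real f (t *\<^sub>R u + (1 - t) *\<^sub>R v)
               \<le> t * conjugate_real f u + (1 - t) * conjugate_real f v
                 - 1 / (2 * L) * t * (1 - t) * (norm (u - v))\<^sup>2))
       \<and> (L_smooth L f \<longleftrightarrow>
          (\<forall>u v. (gradient (conjugate_real f) u - gradient (conjugate_real f) v) \<bullet> (u - v)
               \<ge> 1 / L * (norm (u - v))\<^sup>2))
       \<and> (L_smooth L f \<longleftrightarrow>
          (\<forall>u v. conjugate_real f u
               \<ge> conjugate_real f v + gradient (conjugate_real f) v \<bullet> (u - v)
                 + 1 / (2 * L) * (norm (u - v))\<^sup>2))"
    (is "(_ \<longleftrightarrow> ?a) \<and> (_ \<longleftrightarrow> ?b) \<and> (_ \<longleftrightarrow> ?c)")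
proof -
  let ?g = "conjugate_real f" and ?k = "1 / (2 * L)"
  have diff: "?g differentiable (at u)" for u
    by (rule Gamma_funD(4)[OF assms(2)])
  have k: "2 * ?k = 1 / L"
    by simp
  have "L_smooth L f \<longleftrightarrow> ?c"
    by (rule L_smooth_iff_quadratic_lower_bound_conjugate[OF assms])
  moreover have "?a \<longleftrightarrow> ?c"
  proof
    assume a: ?a
    show ?c
      by (intro allI strongly_convex_imp_quadratic_lower_bound diff) (use a in auto)
  next
    assume c: ?c
    show ?a
      by (intro allI ballI quadratic_lower_bound_imp_strongly_convex) (use c in auto)
  qed
  moreover have "?b \<longleftrightarrow> ?c"
  proof
    assume b: ?b
    show ?c
      by (intro allI strongly_monotone_gradient_imp_quadratic_lower_bound diff)
        (unfold k, use b in blast)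
  next
    assume c: ?c
    show ?b
      unfolding k[symmetric]
      by (intro allI quadratic_lower_bound_imp_strongly_monotone_gradient) (use c in blast)
  qed
  ultimately show ?thesis
    by blast
qed

end
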